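(* Let $n_t\ge 2$, $n_r\ge 1$, $n_e\ge 1$ be integers, let $\mathbf{H}\in\mathbb{R}^{n_r\times n_t}$ and $\mathbf{G}\in\mathbb{R}^{n_e\times n_t}$ be arbitrary real matrices, and let $P_t>0$. Let $$\mathcal{C}_s=\max_{\mathbf{Q}\succeq \mathbf{0},\ \mathrm{tr}(\mathbf{Q})\le P_t}\ \frac12\log_2\frac{|\mathbf{I}_{n_r}+\mathbf{H}\mathbf{Q}\mathbf{H}^T|}{|\mathbf{I}_{n_e}+\mathbf{G}\mathbf{Q}\mathbf{G}^T|},$$ where the maximum is over real symmetric positive semidefinite matrices $\mathbf{Q}\in\mathbb{R}^{n_t\times n_t}$ with trace at most $P_t$. Then, to reach $\mathcal{C}_s$, it is sufficient to use covariance matrices of the form $\mathbf{Q}=\mathbf{V}\mathbf{\Lambda}\mathbf{V}^T$ with $\mathbf{\Lambda}$ diagonal positive semidefinite and $\mathbf{V}$ an ordered product of Givens rotations. That is, there exist a diagonal matrix $\mathbf{\Lambda}=\mathrm{diag}(\lambda_1,\dots,\lambda_{n_t})$ with all $\lambda_i\ge 0$ and real angles $\theta_{ij}$, $1\le i<j\le n_t$, such that, with $$\mathbf{V}=\prod_{i=1}^{n_t-1}\ \prod_{j=i+1}^{n_t}\mathbf{V}_{ij}$$ where $\mathbf{V}_{ij}$ is the Givens rotation with angle $\theta_{ij}$ in the $(i,j)$ coordinate plane, the matrix $\mathbf{Q}=\mathbf{V}\mathbf{\Lambda}\mathbf{V}^T$ is symmetric positive semidefinite, satisfies $\mathrm{tr}(\mathbf{Q})\le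 P_t$, and satisfies $$\frac12\log_2\frac{|\mathbf{I}_{n_r}+\mathbf{H}\mathbf{Q}\mathbf{H}^T|}{|\mathbf{I}_{n_e}+\mathbf{G}\mathbf{Q}\mathbf{G}^T|}=\mathcal{C}_s.$$
   Context: Here $|\mathbf{A}|$ denotes the determinant of a square matrix $\mathbf{A}$, $\mathbf{I}_n$ the $n\times n$ identity matrix, $\mathrm{tr}$ the trace, and $\mathbf{Q}\succeq\mathbf{0}$ means that $\mathbf{Q}$ is real symmetric positive semidefinite. The quantity $\mathcal{C}_s$ is the known expression for the secrecy capacity of the Gaussian MIMOME (multiple-input multiple-output multiple-eavesdropper) wiretap channel with $n_t$, $n_r$, $n_e$ antennas at the transmitter, legitimate receiver and eavesdropper, real channel matrices $\mathbf{H}$ (to the receiver) and $\mathbf{G}$ (to the eavesdropper), unit-variance white Gaussian noise, and total transmit power $P_t$; $\mathbf{Q}$ is the covariance matrix of the channel input. For the purposes of the claim, $\mathcal{C}_s$ is defined by the displayed maximum. For $1\le i<j\le n_t$ and $\theta_{ij}\in\mathbb{R}$, the Givens rotation $\mathbf{V}_{ij}\in\mathbb{R}^{n_t\times n_t}$ is the matrix that agrees with the identity $\mathbf{I}_{n_t}$ except in the four entries $$\mathbf{V}_{ij}(i,i)=\cos\theta_{ij},\quad \mathbf{V}_{ij}(i,j)=-\sin\theta_{ij},\quad \mathbf{V}_{ij}(j,i)=\sin\theta_{ij},\quad \mathbf{V}_{ij}(j,j)=\cos\theta_{ij}.$$ Matrix products are ordered from left to right in increasing index, i.e. $\prod_{i=1}^{n_t-1}\prod_{j=i+1}^{n_t}\mathbf{V}_{ij}=\mathbf{V}_{12}\mathbf{V}_{13}\cdots\mathbf{V}_{1n_t}\mathbf{V}_{23}\cdots\mathbf{V}_{2n_t}\cdots\mathbf{V}_{(n_t-1)n_t}$.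 *)

theory Defs
  imports Complex_Main "Jordan_Normal_Form.Determinant"
begin

definition psd_mat :: "nat \<Rightarrow> real mat \<Rightarrow> bool" where
  "psd_mat n Q \<longleftrightarrow> Q \<in> carrier_mat n n \<and> transpose_mat Q = Q \<and>
     (\<forall>x \<in> carrier_vec n. 0 \<le> x \<bullet> (Q *\<^sub>v x))"

definition mat_trace :: "real mat \<Rightarrow> real" where
  "mat_trace A = (\<Sum>i<dim_row A. A $$ (i, i))"

definition secrecy_rate :: "real mat \<Rightarrow> real mat \<Rightarrow> real mat \<Rightarrow> real" where
  "secrecy_rate H G Q = 1 / 2 * log 2
     (det (1\<^sub>m (dim_row H) + H * Q * transpose_mat H) /
      det (1\<^sub>m (dim_row G) + G * Q * transpose_mat G))"

definition secrecy_capacity :: "nat \<Rightarrow> real mat \<Rightarrow> real mat \<Rightarrow> real \<Rightarrow> real" where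
  "secrecy_capacity n H G P =
     (GREATEST r. \<exists>Q. psd_mat n Q \<and> mat_trace Q \<le> P \<and> r = secrecy_rate H G Q)"

(* Matrix indices start at 0, so the coordinate planes are indexed by 0 <= i < j < n.
   Only the case i < j < n is meaningful. *)
definition givens :: "nat \<Rightarrow> nat \<Rightarrow> nat \<Rightarrow> real \<Rightarrow> real mat" where
  "givens n i j t = mat n n (\<lambda>(r, c).
     if r = i \<and> c = i then cos t
     else if r = i \<and> c = j then - sin t
     else if r = j \<and> c = i then sin t
     else if r = j \<and> c = j then cos t
     else if r = c then 1 else 0)"

(* Factors in lexicographic order of (i, j), multiplied from left to right:
   V_01 V_02 ... V_0(n-1) V_12 ... V_(n-2)(n-1). *)
definition givens_prod :: "nat \<Rightarrow> (nat \<Rightarrow> nat \<Rightarrow> real) \<Rightarrow> real mat" where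
  "givens_prod n \<theta> =
     foldr (*) [givens n i j (\<theta> i j). i \<leftarrow> [0..<n - 1], j \<leftarrow> [i + 1..<n]] (1\<^sub>m n)"

end

theory Submission
  imports Defs "HOL-Analysis.Function_Topology"
begin

text \<open>
  The maximum is attained because the feasible set is compact and the rate is continuous on it.

  To write a maximizer \<open>Q\<close> in the required form, diagonalize it one coordinate at a time. If
  \<open>e\<^sub>0, \<dots>, e\<^bsub>k-1\<^esub>\<close> are already eigenvectors of the current matrix, its trailing block has a unit
  eigenvector, which extended by zeros is an eigenvector \<open>u\<close> of the whole matrix. The product
  \<open>W = V\<^bsub>k,k+1\<^esub> \<cdots> V\<^bsub>k,n-1\<^esub>\<close> fixes \<open>e\<^sub>i\<close> for \<open>i < k\<close> and, for suitable angles, sends \<open>e\<^sub>k\<close> to any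
  unit vector supported on the trailing coordinates. With \<open>W e\<^sub>k = u\<close>, conjugation by \<open>W\<close> makes \<open>e\<^sub>k\<close>
  an eigenvector too. The last coordinate needs no rotation, by symmetry of the matrix.
\<close>

section \<open>Compact boxes and eigenvectors of symmetric matrices\<close>

lemma compact_PiE_UNIV:
  fixes S :: "'i \<Rightarrow> 'b::topological_space set"
  assumes "\<And>i. compact (S i)"
  shows "compact (PiE UNIV S)"
  using assms compactin_PiE[of "\<lambda>_. euclidean" UNIV S]
  by (simp add: euclidean_product_topology)

text \<open>Tychonoff's theorem, with the factor {0} at the coordinates outside \<open>I\<close>.
  The unit sphere and the feasible set are both obtained as closed subsets of such a box.\<close>

lemma compact_box:
  fixes c :: real
  shows "compact {f :: 'i \<Rightarrow> real. \<forall>i. if i \<in> I then \<bar>f i\<bar> \<le> c else f i = 0}"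
proof -
  have "{f :: 'i \<Rightarrow> real. \<forall>i. if i \<in> I then \<bar>f i\<bar> \<le> c else f i = 0} =
      PiE UNIV (\<lambda>i. if i \<in> I then {-c..c} else {0})"
    by (auto simp: PiE_iff abs_le_iff split: if_splits) (smt (verit))+
  then show ?thesis
    by (simp add: compact_PiE_UNIV)
qed

text \<open>First-order condition: the quadratic in \<open>t\<close> has its maximum 0 at
  \<open>t = 0\<close>, so its derivative \<open>2 * b\<close> vanishes there.\<close>

lemma linear_coeff_zero:
  fixes b d :: real
  assumes "\<And>t. 2 * t * b + t\<^sup>2 * d \<le> 0"
  shows "b = 0"
proof -
  \<comment> \<open>This makes \<open>2 * D + d\<close> positive, so that at
    \<open>t = b / D\<close> the quadratic is a positive multiple of
    \<open>b\<^sup>2\<close>.\<close>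
  define D where "D = \<bar>d\<bar> + 1"
  have D: "D > 0" "2 * D + d > 0" unfolding D_def by auto
  have "2 * (b / D) * b + (b / D)\<^sup>2 * d = b\<^sup>2 * (2 * D + d) / D\<^sup>2"
    using D by (simp add: power2_eq_square field_simps)
  then have "b\<^sup>2 * (2 * D + d) / D\<^sup>2 \<le> 0"
    using assms[of "b / D"] by simp
  then have "b\<^sup>2 * (2 * D + d) \<le> 0"
    using D zero_less_power[of D 2] by (simp add: pos_divide_le_eq)
  then show ?thesis
    using D by (simp add: mult_le_0_iff)
qed

text \<open>A maximizer of the quadratic form on the unit sphere is an eigenvector, by first variation.\<close>

lemma symmetric_eigenvector:
  fixes a :: "'i \<Rightarrow> 'i \<Rightarrow> real"
  assumes fin: "finite I" and ne: "I \<noteq> {}"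
    and sym: "\<And>i j. i \<in> I \<Longrightarrow> j \<in> I \<Longrightarrow> a i j = a j i"
  obtains x l where "(\<Sum>i\<in>I. (x i)\<^sup>2) = 1" "\<And>i. i \<in> I \<Longrightarrow> (\<Sum>j\<in>I. a i j * x j) = l * x i"
proof -
  define q where "q x = (\<Sum>i\<in>I. \<Sum>j\<in>I. a i j * x i * x j)" for x
  \<comment> \<open>The unit sphere over \<open>I\<close>, extended by zero and presented as a
    closed subset of a compact box.\<close>
  define S where "S = {f :: 'i \<Rightarrow> real. \<forall>i. if i \<in> I then \<bar>f i\<bar> \<le> 1 else f i = 0} \<inter>
     {f. (\<Sum>i\<in>I. (f i)\<^sup>2) = 1}"
  have "closed {f :: 'i \<Rightarrow> real. (\<Sum>i\<in>I. (f i)\<^sup>2) = 1}"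
    by (intro closed_Collect_eq continuous_intros continuous_on_product_coordinates)
  then have cS: "compact S"
    unfolding S_def by (intro compact_Int_closed compact_box)
  obtain i1 where i1: "i1 \<in> I" using ne by auto
  have "(\<lambda>i. if i = i1 then 1 else 0) \<in> S"
    using i1 fin by (auto simp: S_def if_distrib[of "\<lambda>x. x\<^sup>2"] cong: if_cong)
  then have "S \<noteq> {}" by auto
  moreover have "continuous_on S q"
    unfolding q_def
    by (intro continuous_intros) (auto intro: continuous_on_subset[OF continuous_on_product_coordinates])
  ultimately obtain x where xS: "x \<in> S" and xmax: "\<And>y. y \<in> S \<Longrightarrow> q y \<le> q x"
    using continuous_attains_sup[OF cS] by blast
  have x1: "(\<Sum>i\<in>I. (x i)\<^sup>2) = 1" using xS by (simp add: S_def)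
  \<comment> \<open>Both sides are homogeneous of degree two in \<open>y\<close>, so the maximum on
    the sphere gives a bound everywhere.\<close>
  have le: "q y \<le> q x * (\<Sum>i\<in>I. (y i)\<^sup>2)" for y
  proof (cases "(\<Sum>i\<in>I. (y i)\<^sup>2) = 0")
    case True
    then have "\<forall>i\<in>I. y i = 0" using fin by (simp add: sum_nonneg_eq_0_iff)
    then have "q y = 0" unfolding q_def by simp
    then show ?thesis using True by simp
  next
    case False
    define N where "N = (\<Sum>i\<in>I. (y i)\<^sup>2)"
    have N: "N > 0" using False unfolding N_def
      by (metis sum_nonneg zero_le_power2 order_le_less)
    define z where "z i = (if i \<in> I then y i / sqrt N else 0)" for i
    have z1: "(\<Sum>i\<in>I. (z i)\<^sup>2) = 1"
    proof -
      have "(\<Sum>i\<in>I. (z i)\<^sup>2) = (\<Sum>i\<in>I. (y i)\<^sup>2 / N)"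
        using N by (intro sum.cong) (auto simp: z_def power_divide)
      also have "\<dots> = 1" using N by (simp add: sum_divide_distrib[symmetric] N_def[symmetric])
      finally show ?thesis .
    qed
    have "\<bar>z i\<bar> \<le> 1" if "i \<in> I" for i
    proof -
      have "(z i)\<^sup>2 \<le> (\<Sum>i\<in>I. (z i)\<^sup>2)"
        using fin that by (intro member_le_sum) auto
      then show ?thesis using z1 by (simp add: abs_square_le_1)
    qed
    then have "z \<in> S" using z1 by (auto simp: S_def z_def)
    then have "q z \<le> q x" by (rule xmax)
    moreover have "q z = q y / N"
    proof -
      have "q z = (\<Sum>i\<in>I. \<Sum>j\<in>I. a i j * y i * y j / N)"
        unfolding q_def using N by (intro sum.cong) (auto simp: z_def)
      then show ?thesis by (simp add: q_def sum_divide_distrib)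
    qed
    ultimately show ?thesis using N by (simp add: field_simps N_def[symmetric])
  qed
  have "(\<Sum>j\<in>I. a i0 j * x j) = q x * x i0" if i0: "i0 \<in> I" for i0
  proof -
    define d where "d i = (if i = i0 then 1 else 0 :: real)" for i
    define c where "c = (\<Sum>j\<in>I. a i0 j * x j)"
    \<comment> \<open>This is \<open>le\<close> at \<open>x\<close> perturbed by \<open>t\<close> in
      direction \<open>i0\<close>. The linear coefficient is zero exactly when row \<open>i0\<close>
      of the eigenvalue equation holds with eigenvalue \<open>q x\<close>.\<close>
    have "2 * t * (c - q x * x i0) + t\<^sup>2 * (a i0 i0 - q x) \<le> 0" for t
    proof -
      define y where "y i = x i + t * d i" for i
      have pick: "(\<Sum>i\<in>I. d i * g i) = g i0" for g
        using fin i0 sum.delta[of I i0 g] by (simp add: d_def if_distrib[of "\<lambda>u. u * _"] cong: if_cong)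
      have s1: "(\<Sum>i\<in>I. \<Sum>j\<in>I. a i j * d i * x j) = c"
        using pick[of "\<lambda>i. \<Sum>j\<in>I. a i j * x j"] by (simp add: c_def sum_distrib_left mult_ac)
      have s2: "(\<Sum>i\<in>I. \<Sum>j\<in>I. a i j * x i * d j) = c"
        by (subst sum.swap, subst s1[symmetric], intro sum.cong) (auto simp: sym)
      have s3: "(\<Sum>i\<in>I. \<Sum>j\<in>I. a i j * d i * d j) = a i0 i0"
      proof -
        have "(\<Sum>i\<in>I. \<Sum>j\<in>I. a i j * d i * d j) = (\<Sum>i\<in>I. d i * (\<Sum>j\<in>I. d j * a i j))"
          by (simp add: sum_distrib_left mult_ac)
        then show ?thesis by (simp only: pick)
      qed
      have qy: "q y = q x + t * (\<Sum>i\<in>I. \<Sum>j\<in>I. a i j * d i * x j) + t * (\<Sum>i\<in>I. \<Sum>j\<in>I. a i j * x i * d j)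
          + t\<^sup>2 * (\<Sum>i\<in>I. \<Sum>j\<in>I. a i j * d i * d j)"
        unfolding q_def y_def sum_distrib_left sum.distrib[symmetric]
        by (intro sum.cong) (auto simp: algebra_simps power2_eq_square)
      have "(\<Sum>i\<in>I. (y i)\<^sup>2) = (\<Sum>i\<in>I. (x i)\<^sup>2) + 2 * t * (\<Sum>i\<in>I. d i * x i)
          + t\<^sup>2 * (\<Sum>i\<in>I. d i * d i)"
        unfolding y_def sum_distrib_left sum.distrib[symmetric]
        by (intro sum.cong) (auto simp: algebra_simps power2_eq_square)
      then have "(\<Sum>i\<in>I. (y i)\<^sup>2) = 1 + 2 * t * x i0 + t\<^sup>2"
        by (simp add: pick x1) (simp add: d_def)
      then show ?thesis
        using le[of y] qy unfolding s1 s2 s3 by (simp add: algebra_simps)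
    qed
    then have "c - q x * x i0 = 0" by (rule linear_coeff_zero)
    then show ?thesis by (simp add: c_def)
  qed
  with x1 show ?thesis by (rule that)
qed

section \<open>Ordered matrix products and orthogonal matrices\<close>

lemma mult_unit_vec_col:
  fixes M :: "'a::comm_semiring_1 mat"
  assumes "M \<in> carrier_mat m n" "j < n"
  shows "M *\<^sub>v unit_vec n j = col M j"
  using assms by (intro eq_vecI) auto

text \<open>The columns of a matrix are the images of the unit vectors. Orthogonality of products
  and rotations is checked on vectors this way.\<close>

lemma mat_eqI_mult_vec:
  fixes M N :: "'a::comm_semiring_1 mat"
  assumes "M \<in> carrier_mat m n" "N \<in> carrier_mat m n"
    and "\<And>v. v \<in> carrier_vec n \<Longrightarrow> M *\<^sub>v v = N *\<^sub>v v"
  shows "M = N"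
proof (rule mat_col_eqI)
  fix j assume "j < dim_col N"
  then show "col M j = col N j"
    using assms(1,2) assms(3)[of "unit_vec n j"] by (simp add: mult_unit_vec_col)
qed (use assms in auto)

abbreviation mat_prod :: "nat \<Rightarrow> real mat list \<Rightarrow> real mat" where
  "mat_prod n Ms \<equiv> foldr (*) Ms (1\<^sub>m n)"

lemma mat_prod_carrier:
  "set Ms \<subseteq> carrier_mat n n \<Longrightarrow> mat_prod n Ms \<in> carrier_mat n n"
  by (induction Ms) (auto intro: mult_carrier_mat)

lemma mat_prod_append:
  assumes "set Ms \<subseteq> carrier_mat n n" "set Ns \<subseteq> carrier_mat n n"
  shows "mat_prod n (Ms @ Ns) = mat_prod n Ms * mat_prod n Ns"
  using assms
proof (induction Ms)
  case Nil
  then show ?case by (simp add: left_mult_one_mat[OF mat_prod_carrier])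
next
  case (Cons M Ms)
  then have "M * (mat_prod n Ms * mat_prod n Ns) = M * mat_prod n Ms * mat_prod n Ns"
    by (intro assoc_mult_mat[symmetric, of _ n n _ n _ n] mat_prod_carrier) auto
  then show ?case using Cons by simp
qed

definition orthogonal :: "nat \<Rightarrow> real mat \<Rightarrow> bool" where
  "orthogonal n V \<longleftrightarrow> V \<in> carrier_mat n n \<and> transpose_mat V * V = 1\<^sub>m n"

lemma orthogonal_carrier: "orthogonal n V \<Longrightarrow> V \<in> carrier_mat n n"
  by (simp add: orthogonal_def)

lemma orthogonal_one: "orthogonal n (1\<^sub>m n)"
  by (simp add: orthogonal_def)

lemma orthogonal_transpose_mult_vec:
  assumes "orthogonal n V" "v \<in> carrier_vec n"
  shows "transpose_mat V *\<^sub>v (V *\<^sub>v v) = v"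
  using assms assoc_mult_mat_vec[of "transpose_mat V" n n V n v] by (simp add: orthogonal_def)

text \<open>For square matrices a left inverse is also a right inverse.\<close>

lemma orthogonal_right:
  assumes "orthogonal n V"
  shows "V * transpose_mat V = 1\<^sub>m n"
  using assms mat_mult_left_right_inverse[of "transpose_mat V" n V] by (simp add: orthogonal_def)

lemma orthogonal_mult:
  assumes V: "orthogonal n V" and W: "orthogonal n W"
  shows "orthogonal n (V * W)"
  unfolding orthogonal_def
proof
  note c = orthogonal_carrier[OF V] orthogonal_carrier[OF W]
  show "V * W \<in> carrier_mat n n" using c by simp
  show "transpose_mat (V * W) * (V * W) = 1\<^sub>m n"
    using c by (intro mat_eqI_mult_vec[of _ n n])
      (auto simp: transpose_mult[of _ n n] assoc_mult_mat_vec[of _ n n _ n]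
          orthogonal_transpose_mult_vec[OF V] orthogonal_transpose_mult_vec[OF W])
qed

lemma orthogonal_mat_prod:
  "(\<And>V. V \<in> set Ms \<Longrightarrow> orthogonal n V) \<Longrightarrow> orthogonal n (mat_prod n Ms)"
  by (induction Ms) (auto intro: orthogonal_mult orthogonal_one)

section \<open>Givens rotations and their row products\<close>

lemma givens_carrier: "givens n i j t \<in> carrier_mat n n"
  by (simp add: givens_def)

lemma givens_mult_vec:
  assumes "i < j" "j < n" "v \<in> carrier_vec n"
  shows "givens n i j t *\<^sub>v v = vec n (\<lambda>r. if r = i then cos t * v $ i - sin t * v $ j
     else if r = j then sin t * v $ i + cos t * v $ j else v $ r)"
proof (rule eq_vecI)
  fix r assume "r < dim_vec (vec n (\<lambda>r. if r = i then cos t * v $ i - sin t * v $ j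
     else if r = j then sin t * v $ i + cos t * v $ j else v $ r))"
  then have r: "r < n" by simp
  have "(givens n i j t *\<^sub>v v) $ r = (\<Sum>c\<in>{0..<n}. givens n i j t $$ (r, c) * v $ c)"
    using r assms by (simp add: scalar_prod_def givens_def)
  \<comment> \<open>Splitting into terms supported at a single \<open>c\<close> lets the sum
    collapse. The third term is switched off for \<open>r = i\<close> and \<open>r = j\<close>,
    where the first two already account for the diagonal entry.\<close>
  also have "\<dots> = (\<Sum>c\<in>{0..<n}.
      (if c = i then (if r = i then cos t else if r = j then sin t else 0) * v $ i else 0) +
      (if c = j then (if r = i then - sin t else if r = j then cos t else 0) * v $ j else 0) +
      (if c = r then (if r = i \<or> r = j then 0 else 1) * v $ r else 0))"
    using r assms by (intro sum.cong) (auto simp: givens_def)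
  also have "\<dots> = (if r = i then cos t * v $ i - sin t * v $ j
     else if r = j then sin t * v $ i + cos t * v $ j else v $ r)"
    using r assms by (auto simp: sum.distrib)
  finally show "(givens n i j t *\<^sub>v v) $ r = vec n (\<lambda>r. if r = i then cos t * v $ i - sin t * v $ j
     else if r = j then sin t * v $ i + cos t * v $ j else v $ r) $ r"
    using r by simp
qed (simp add: givens_def)

lemma givens_transpose: "i < j \<Longrightarrow> transpose_mat (givens n i j t) = givens n i j (- t)"
  by (rule eq_matI) (auto simp: givens_def)

text \<open>The transpose is the rotation by \<open>- t\<close>, which undoes the rotation by
  \<open>t\<close> because cos^2 + sin^2 = 1.\<close>

lemma orthogonal_givens:
  assumes "i < j" "j < n"
  shows "orthogonal n (givens n i j t)"
proof -
  have sc: "x * (cos t * cos t) + x * (sin t * sin t) = x" for x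
    unfolding distrib_left[symmetric] by simp
  have rot: "cos t * (cos t * a - sin t * b) + sin t * (sin t * a + cos t * b) = a"
    "cos t * (sin t * a + cos t * b) - sin t * (cos t * a - sin t * b) = b" for a b
    by (simp_all add: algebra_simps sc)
  have "givens n i j (- t) *\<^sub>v (givens n i j t *\<^sub>v v) = v" if "v \<in> carrier_vec n" for v
    using assms that by (intro eq_vecI) (auto simp: givens_mult_vec rot)
  then show ?thesis
    using assms givens_carrier[of n i j]
    by (auto simp: orthogonal_def givens_transpose assoc_mult_mat_vec[of _ n n _ n]
        intro!: mat_eqI_mult_vec[of _ n n] mult_carrier_mat[of _ n n])
qed

text \<open>The block of factors of \<open>givens_prod\<close> with first index \<open>k\<close>,
  called W in the outline.\<close>

definition givens_row :: "nat \<Rightarrow> nat \<Rightarrow> (nat \<Rightarrow> real) \<Rightarrow> real mat" where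
  "givens_row n k \<theta> = mat_prod n (map (\<lambda>j. givens n k j (\<theta> j)) [k + 1..<n])"

lemma orthogonal_givens_row: "orthogonal n (givens_row n k \<theta>)"
  unfolding givens_row_def by (rule orthogonal_mat_prod) (auto intro: orthogonal_givens)

text \<open>Every factor moves only the coordinates \<open>k\<close> and
  \<open>j > k\<close>.\<close>

lemma givens_row_unit_vec:
  assumes "i < k" "k < n"
  shows "givens_row n k \<theta> *\<^sub>v unit_vec n i = unit_vec n i"
proof -
  have "mat_prod n (map (\<lambda>j. givens n k j (\<theta> j)) js) *\<^sub>v unit_vec n i = unit_vec n i"
    if "set js \<subseteq> {k<..<n}" for js
    using that
  proof (induction js)
    case (Cons j js)
    have "givens n k j (\<theta> j) *\<^sub>v unit_vec n i = unit_vec n i"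
      using Cons.prems assms by (intro eq_vecI) (auto simp: givens_mult_vec)
    moreover have "mat_prod n (map (\<lambda>j. givens n k j (\<theta> j)) js) \<in> carrier_mat n n"
      by (intro mat_prod_carrier) (auto simp: givens_carrier)
    ultimately show ?case
      using Cons by (simp add: assoc_mult_mat_vec[OF givens_carrier])
  qed simp
  then show ?thesis unfolding givens_row_def by (simp add: subset_iff)
qed

text \<open>Spherical coordinates: each angle splits a length into one entry of \<open>u\<close> and
  the length of the entries before it. Since \<open>k + 1 < n\<close> there is at least one
  rotation; with none, a negative entry \<open>k\<close> could not be produced.\<close>

lemma givens_row_reaches:
  assumes kn: "k + 1 < n" and u: "u \<in> carrier_vec n" and zero: "\<And>i. i < k \<Longrightarrow> u $ i = 0"
    and unit: "(\<Sum>i\<in>{k..<n}. (u $ i)\<^sup>2) = 1"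
  obtains \<theta> where "givens_row n k \<theta> *\<^sub>v unit_vec n k = u"
proof -
  \<comment> \<open>The length of the entries \<open>k..j\<close> of \<open>u\<close>, except that
    \<open>s k\<close> keeps the sign of \<open>u $ k\<close>.\<close>
  define s where "s j = (if j = k then u $ k else sqrt (\<Sum>i\<in>{k..j}. (u $ i)\<^sup>2))" for j
  have s2: "(s j)\<^sup>2 = (\<Sum>i\<in>{k..j}. (u $ i)\<^sup>2)" if "k \<le> j" for j
    by (auto simp: s_def sum_nonneg)
  \<comment> \<open>The required angle rotates (\<open>s j\<close>, 0) in the plane of
    \<open>k\<close> and \<open>j\<close> to (\<open>s (j - 1)\<close>, \<open>u $ j\<close>). If
    \<open>s j = 0\<close>, both targets are 0 and any angle serves.\<close>
  have "\<exists>t. k < j \<longrightarrow> s j * cos t = s (j - 1) \<and> s j * sin t = u $ j" for j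
  proof (cases "k < j")
    case True
    have "{k..j} = insert j {k..j - 1}" using True by auto
    then have sq: "(s j)\<^sup>2 = (s (j - 1))\<^sup>2 + (u $ j)\<^sup>2"
      using True by (simp add: s2)
    show ?thesis
    proof (cases "s j = 0")
      case True
      then show ?thesis using sq by (simp add: sum_power2_eq_zero_iff)
    next
      case False
      then have "(s (j - 1) / s j)\<^sup>2 + (u $ j / s j)\<^sup>2 = 1"
        unfolding power_divide add_divide_distrib[symmetric] sq[symmetric] by simp
      then obtain t where "s (j - 1) / s j = cos t" "u $ j / s j = sin t"
        by (rule sincos_total_2pi)
      then show ?thesis using False by (auto simp: field_simps intro!: exI[of _ t])
    qed
  qed auto
  then obtain \<theta> where \<theta>: "\<And>j. k < j \<Longrightarrow> s j * cos (\<theta> j) = s (j - 1)"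
      "\<And>j. k < j \<Longrightarrow> s j * sin (\<theta> j) = u $ j"
    by metis
  \<comment> \<open>The partial product over \<open>j < m\<close> maps \<open>w m\<close> to \<open>u\<close>: each factor absorbs one more entry of \<open>u\<close> into
     entry \<open>k\<close>. Entry \<open>k\<close> is nonnegative only after the first step, whence the case split in \<open>s\<close>.\<close>
  define w where "w m = vec n (\<lambda>i. if i = k then s (m - 1) else if i < m then 0 else u $ i)" for m
  have "mat_prod n (map (\<lambda>j. givens n k j (\<theta> j)) [k + 1..<m]) *\<^sub>v w m = u"
    if "k + 1 \<le> m" "m \<le> n" for m
    using that
  proof (induction m rule: nat_induct_at_least)
    case base
    have "w (k + 1) = u"
      using u zero by (intro eq_vecI) (auto simp: w_def s_def)
    then show ?case using u by simp
  next
    case (Suc m)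
    let ?M = "mat_prod n (map (\<lambda>j. givens n k j (\<theta> j)) [k + 1..<m])"
    have M: "?M \<in> carrier_mat n n"
      by (intro mat_prod_carrier) (auto simp: givens_carrier)
    \<comment> \<open>The new factor stands rightmost, so it acts first and turns
      \<open>w (Suc m)\<close> into \<open>w m\<close>.\<close>
    have "mat_prod n (map (\<lambda>j. givens n k j (\<theta> j)) [k + 1..<Suc m]) =
        ?M * givens n k m (\<theta> m)"
      using Suc.hyps
        mat_prod_append[of "map (\<lambda>j. givens n k j (\<theta> j)) [k + 1..<m]" n "[givens n k m (\<theta> m)]"]
      by (simp add: image_subset_iff givens_carrier right_mult_one_mat[OF givens_carrier])
    moreover have "(?M * givens n k m (\<theta> m)) *\<^sub>v w (Suc m) = ?M *\<^sub>v (givens n k m (\<theta> m) *\<^sub>v w (Suc m))"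
      by (rule assoc_mult_mat_vec[OF M givens_carrier]) (simp add: w_def)
    moreover have "givens n k m (\<theta> m) *\<^sub>v w (Suc m) = w m"
      using Suc \<theta>[of m] by (intro eq_vecI) (auto simp: givens_mult_vec w_def mult.commute)
    ultimately show ?case
      using Suc.IH Suc.prems by (metis Suc_leD)
  qed
  from this[of n] have "givens_row n k \<theta> *\<^sub>v w n = u"
    using kn by (simp add: givens_row_def)
  moreover have "w n = unit_vec n k"
  proof -
    \<comment> \<open>As \<open>n - 1 > k\<close>, the square root branch of \<open>s\<close>
      applies and yields 1, not -1.\<close>
    have "{k..n - 1} = {k..<n}" using kn by auto
    then have "s (n - 1) = 1" using kn unit by (simp add: s_def)
    then show ?thesis using kn by (intro eq_vecI) (auto simp: w_def)
  qed
  ultimately show ?thesis using that by simp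
qed

section \<open>Diagonalization one coordinate at a time\<close>

definition eigen_unit :: "nat \<Rightarrow> real mat \<Rightarrow> nat \<Rightarrow> bool" where
  "eigen_unit n A i \<longleftrightarrow> (\<exists>l. A *\<^sub>v unit_vec n i = l \<cdot>\<^sub>v unit_vec n i)"

lemma eigen_unit_entry:
  assumes "eigen_unit n A j" "A \<in> carrier_mat n n" "i < n" "j < n" "i \<noteq> j"
  shows "A $$ (i, j) = 0"
proof -
  obtain l where "A *\<^sub>v unit_vec n j = l \<cdot>\<^sub>v unit_vec n j"
    using assms(1) by (auto simp: eigen_unit_def)
  then have "col A j $ i = (l \<cdot>\<^sub>v unit_vec n j) $ i"
    using assms by (simp add: mult_unit_vec_col)
  then show ?thesis using assms by simp
qed

text \<open>An eigenvector \<open>W *\<^sub>v unit_vec n i\<close> of \<open>A\<close> is carried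
  back to the unit vector by \<open>transpose_mat W\<close>, which inverts \<open>W\<close>.\<close>

lemma eigen_unit_conj:
  assumes W: "orthogonal n W" and A: "A \<in> carrier_mat n n"
    and ev: "A *\<^sub>v (W *\<^sub>v unit_vec n i) = l \<cdot>\<^sub>v (W *\<^sub>v unit_vec n i)"
  shows "eigen_unit n (transpose_mat W * A * W) i"
proof -
  note Wc = orthogonal_carrier[OF W]
  have "(transpose_mat W * A * W) *\<^sub>v unit_vec n i =
      transpose_mat W *\<^sub>v (A *\<^sub>v (W *\<^sub>v unit_vec n i))"
    using Wc A by (simp add: assoc_mult_mat_vec[of _ n n _ n])
  also have "\<dots> = l \<cdot>\<^sub>v unit_vec n i"
    using Wc orthogonal_transpose_mult_vec[OF W, of "unit_vec n i"]
    by (simp add: ev mult_mat_vec[of _ n n])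
  finally show ?thesis by (auto simp: eigen_unit_def)
qed

lemma eigen_unit_step:
  assumes A: "A \<in> carrier_mat n n" and sym: "transpose_mat A = A" and kn: "k + 1 < n"
    and ev: "\<And>i. i < k \<Longrightarrow> eigen_unit n A i"
  obtains \<theta> where "\<And>i. i < Suc k \<Longrightarrow>
     eigen_unit n (transpose_mat (givens_row n k \<theta>) * A * givens_row n k \<theta>) i"
proof -
  have symA: "A $$ (i, j) = A $$ (j, i)" if "i < n" "j < n" for i j
    using that A sym by (metis carrier_matD index_transpose_mat(1))
  \<comment> \<open>Columns below \<open>k\<close> vanish off the diagonal, hence by symmetry so do
    the rows. This decoupling is why an eigenvector of the trailing block may be extended by
    zeros.\<close>
  have zero: "A $$ (i, j) = 0" if "i < k" "k \<le> j" "j < n" for i j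
    using that ev[of i] A eigen_unit_entry[of n A i j] symA[of i j] by auto
  obtain x l where x1: "(\<Sum>i\<in>{k..<n}. (x i)\<^sup>2) = 1"
    and xl: "\<And>i. i \<in> {k..<n} \<Longrightarrow> (\<Sum>j\<in>{k..<n}. A $$ (i, j) * x j) = l * x i"
    by (rule symmetric_eigenvector[of "{k..<n}" "\<lambda>i j. A $$ (i, j)"]) (use kn symA in auto)
  define u where "u = vec n (\<lambda>i. if i < k then 0 else x i)"
  have u: "u \<in> carrier_vec n" by (simp add: u_def)
  have "A *\<^sub>v u = l \<cdot>\<^sub>v u"
  proof (rule eq_vecI)
    fix i assume "i < dim_vec (l \<cdot>\<^sub>v u)"
    then have i: "i < n" by (simp add: u_def)
    have "(A *\<^sub>v u) $ i = (\<Sum>j\<in>{0..<n}. A $$ (i, j) * u $ j)"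
      using A i u by (simp add: scalar_prod_def)
    also have "\<dots> = (\<Sum>j\<in>{k..<n}. A $$ (i, j) * x j)"
      by (rule sum.mono_neutral_cong_right) (auto simp: u_def)
    also have "\<dots> = l * u $ i"
      using i xl[of i] zero[of i] by (cases "i < k") (auto simp: u_def)
    finally show "(A *\<^sub>v u) $ i = (l \<cdot>\<^sub>v u) $ i" using i u by simp
  qed (use A u in auto)
  moreover obtain \<theta> where \<theta>: "givens_row n k \<theta> *\<^sub>v unit_vec n k = u"
    by (rule givens_row_reaches[OF kn u]) (use kn x1 in \<open>auto simp: u_def\<close>)
  ultimately have "eigen_unit n (transpose_mat (givens_row n k \<theta>) * A * givens_row n k \<theta>) i"
    if "i < Suc k" for i
  \<comment> \<open>For \<open>i = k\<close> the row product yields the new eigenvector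
    \<open>u\<close>; for \<open>i < k\<close> it fixes the old one.\<close>
  proof (cases "i = k")
    case False
    then have "i < k" using that by simp
    then obtain l' where "A *\<^sub>v unit_vec n i = l' \<cdot>\<^sub>v unit_vec n i"
      using ev unfolding eigen_unit_def by blast
    then show ?thesis
      using \<open>i < k\<close> kn
      by (intro eigen_unit_conj[OF orthogonal_givens_row A, of _ _ _ l']) (simp add: givens_row_unit_vec)
  qed (auto intro!: eigen_unit_conj[OF orthogonal_givens_row A])
  then show ?thesis by (rule that)
qed

text \<open>The first \<open>k\<close> row blocks of \<open>givens_prod\<close>, so that induction
  can run over the rows.\<close>

definition givens_rows :: "nat \<Rightarrow> nat \<Rightarrow> (nat \<Rightarrow> nat \<Rightarrow> real) \<Rightarrow> real mat" where
  "givens_rows n k \<theta> = mat_prod n (concat (map (\<lambda>i. map (\<lambda>j. givens n i j (\<theta> i j)) [i + 1..<n]) [0..<k]))"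

lemma givens_prod_rows: "givens_prod n \<theta> = givens_rows n (n - 1) \<theta>"
  by (simp add: givens_prod_def givens_rows_def)

lemma givens_rows_0: "givens_rows n 0 \<theta> = 1\<^sub>m n"
  by (simp add: givens_rows_def)

lemma givens_rows_Suc: "givens_rows n (Suc k) \<theta> = givens_rows n k \<theta> * givens_row n k (\<theta> k)"
  unfolding givens_rows_def givens_row_def
  by (subst mat_prod_append[symmetric]) (auto simp: givens_carrier simp del: foldr_append)

text \<open>Allows the angles of row \<open>k\<close> to be chosen later without disturbing the rows
  before it.\<close>

lemma givens_rows_cong:
  "(\<And>i. i < k \<Longrightarrow> \<theta> i = \<theta>' i) \<Longrightarrow> givens_rows n k \<theta> = givens_rows n k \<theta>'"
  unfolding givens_rows_def by (auto intro!: arg_cong[of _ _ "\<lambda>x. mat_prod n (concat x)"])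

lemma orthogonal_givens_rows: "orthogonal n (givens_rows n k \<theta>)"
  by (induction k) (auto simp: givens_rows_0 givens_rows_Suc
      intro: orthogonal_one orthogonal_mult orthogonal_givens_row)

lemma transpose_congruence:
  fixes A V :: "real mat"
  assumes "A \<in> carrier_mat n n" "transpose_mat A = A" "V \<in> carrier_mat m n"
  shows "transpose_mat (V * A * transpose_mat V) = V * A * transpose_mat V"
proof -
  have "transpose_mat (V * A * transpose_mat V) = V * transpose_mat (V * A)"
    using assms by (subst transpose_mult[of _ m n _ m]) auto
  also have "transpose_mat (V * A) = A * transpose_mat V"
    using assms by (subst transpose_mult[of _ m n _ n]) auto
  also have "V * (A * transpose_mat V) = V * A * transpose_mat V"
    using assms by (intro assoc_mult_mat[symmetric, of _ m n _ n _ m]) auto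
  finally show ?thesis .
qed

text \<open>Induction on the number of rows: \<open>eigen_unit_step\<close> is applied to the matrix
  already conjugated by \<open>V\<close>, and the new row multiplies \<open>V\<close> on the right,
  as the prescribed order demands.\<close>

lemma eigen_unit_givens_rows:
  assumes A: "A \<in> carrier_mat n n" and sym: "transpose_mat A = A" and "k \<le> n - 1"
  shows "\<exists>\<theta>. \<forall>i<k. eigen_unit n (transpose_mat (givens_rows n k \<theta>) * A * givens_rows n k \<theta>) i"
  using \<open>k \<le> n - 1\<close>
proof (induction k)
  case (Suc k)
  then obtain \<theta> where \<theta>: "\<And>i. i < k \<Longrightarrow>
      eigen_unit n (transpose_mat (givens_rows n k \<theta>) * A * givens_rows n k \<theta>) i"
    by auto
  define V where "V = givens_rows n k \<theta>"
  have V: "V \<in> carrier_mat n n" unfolding V_def by (rule orthogonal_carrier[OF orthogonal_givens_rows])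
  have "transpose_mat V * A * V \<in> carrier_mat n n" using V A by simp
  moreover have "transpose_mat (transpose_mat V * A * V) = transpose_mat V * A * V"
    using transpose_congruence[OF A sym, of "transpose_mat V"] V by simp
  moreover have "k + 1 < n" using Suc.prems by simp
  moreover have "eigen_unit n (transpose_mat V * A * V) i" if "i < k" for i
    using \<theta>[OF that] by (simp only: V_def)
  ultimately obtain t where t: "\<And>i. i < Suc k \<Longrightarrow>
     eigen_unit n (transpose_mat (givens_row n k t) * (transpose_mat V * A * V) * givens_row n k t) i"
    using eigen_unit_step by metis
  have W: "givens_row n k t \<in> carrier_mat n n"
    by (rule orthogonal_carrier[OF orthogonal_givens_row])
  have VW: "givens_rows n (Suc k) (\<theta>(k := t)) = V * givens_row n k t"
    unfolding givens_rows_Suc V_def using givens_rows_cong[of k "\<theta>(k := t)" \<theta>] by simp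
  have "transpose_mat (V * givens_row n k t) * A * (V * givens_row n k t) =
      transpose_mat (givens_row n k t) * (transpose_mat V * A * V) * givens_row n k t"
    using V W A by (simp add: transpose_mult[of _ n n] assoc_mult_mat[of _ n n _ n _ n])
  with t show ?case
    by (intro exI[of _ "\<theta>(k := t)"] allI impI) (simp only: VW)
qed simp

lemma symmetric_givens_diagonalization:
  assumes A: "A \<in> carrier_mat n n" and sym: "transpose_mat A = A"
  obtains lam \<theta> where "transpose_mat (givens_prod n \<theta>) * A * givens_prod n \<theta> = mat_diag n lam"
proof -
  obtain \<theta> where \<theta>: "\<And>i. i < n - 1 \<Longrightarrow> eigen_unit n (transpose_mat (givens_prod n \<theta>) * A * givens_prod n \<theta>) i"
    using eigen_unit_givens_rows[OF A sym order.refl] by (auto simp: givens_prod_rows)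
  define V where "V = givens_prod n \<theta>"
  have V: "V \<in> carrier_mat n n"
    unfolding V_def givens_prod_rows by (rule orthogonal_carrier[OF orthogonal_givens_rows])
  define D where "D = transpose_mat V * A * V"
  have D: "D \<in> carrier_mat n n" using V A by (simp add: D_def)
  have symD: "transpose_mat D = D"
    using transpose_congruence[OF A sym, of "transpose_mat V"] V by (simp add: D_def)
  have zero: "D $$ (i, j) = 0" if "i < n" "j < n - 1" "i \<noteq> j" for i j
    using that D eigen_unit_entry[of n D j i] \<theta>[of j] by (simp add: D_def V_def)
  have "D $$ (i, j) = 0" if ij: "i < n" "j < n" "i \<noteq> j" for i j
  proof (cases "j < n - 1")
    \<comment> \<open>An entry of the last column is reflected into an earlier column, which is
      already diagonal.\<close>
    case False
    then have "i < n - 1" using ij by auto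
    then have "D $$ (j, i) = 0" using ij zero by simp
    then show ?thesis using ij D symD by (metis carrier_matD index_transpose_mat(1))
  qed (use ij zero in simp)
  then have "D = mat_diag n (\<lambda>i. D $$ (i, i))"
    using D by (intro eq_matI) (auto simp: mat_diag_def)
  then show ?thesis using that unfolding D_def V_def by blast
qed

section \<open>Positive semidefinite matrices\<close>

text \<open>The quadratic form at \<open>x\<close> is that of \<open>Q\<close> at
  \<open>transpose_mat M *\<^sub>v x\<close>.\<close>

lemma psd_mat_congruence:
  assumes Q: "psd_mat n Q" and M: "M \<in> carrier_mat m n"
  shows "psd_mat m (M * Q * transpose_mat M)"
  unfolding psd_mat_def
proof (intro conjI ballI)
  have Qc: "Q \<in> carrier_mat n n" and sym: "transpose_mat Q = Q" using Q by (auto simp: psd_mat_def)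
  show "M * Q * transpose_mat M \<in> carrier_mat m m" using Qc M by simp
  show "transpose_mat (M * Q * transpose_mat M) = M * Q * transpose_mat M"
    by (rule transpose_congruence[OF Qc sym M])
  fix x :: "real vec" assume x: "x \<in> carrier_vec m"
  have "x \<bullet> ((M * Q * transpose_mat M) *\<^sub>v x) = x \<bullet> (M *\<^sub>v (Q *\<^sub>v (transpose_mat M *\<^sub>v x)))"
    using M Qc x by (simp add: assoc_mult_mat_vec[of _ m n _ m] assoc_mult_mat_vec[of _ m n _ n])
  also have "\<dots> = (transpose_mat M *\<^sub>v x) \<bullet> (Q *\<^sub>v (transpose_mat M *\<^sub>v x))"
    using M Qc x by (intro transpose_vec_mult_scalar[symmetric, of _ m n]) auto
  also have "\<dots> \<ge> 0"
    using Q M x by (simp add: psd_mat_def)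
  finally show "0 \<le> x \<bullet> ((M * Q * transpose_mat M) *\<^sub>v x)" .
qed

lemma unit_vec_mult_entry:
  fixes A :: "'a::comm_semiring_1 mat"
  assumes "A \<in> carrier_mat n n" "i < n" "j < n"
  shows "unit_vec n i \<bullet> (A *\<^sub>v unit_vec n j) = A $$ (i, j)"
  using assms by (simp add: mult_unit_vec_col)

lemma psd_mat_diag_nonneg:
  assumes "psd_mat n Q" "i < n"
  shows "0 \<le> Q $$ (i, i)"
  using assms unit_vec_mult_entry[of Q n i i] by (metis psd_mat_def unit_vec_carrier)

text \<open>The diagonalized matrix is congruent to \<open>Q\<close>, so its diagonal entries are
  nonnegative. Orthogonality then solves for \<open>Q\<close>.\<close>

lemma psd_givens_decomposition:
  assumes Q: "psd_mat n Q"
  obtains lam \<theta> where "\<And>i. i < n \<Longrightarrow> lam i \<ge> 0"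
    "Q = givens_prod n \<theta> * mat_diag n lam * transpose_mat (givens_prod n \<theta>)"
proof -
  have Qc: "Q \<in> carrier_mat n n" and sym: "transpose_mat Q = Q" using Q by (auto simp: psd_mat_def)
  obtain lam \<theta> where d: "transpose_mat (givens_prod n \<theta>) * Q * givens_prod n \<theta> = mat_diag n lam"
    by (rule symmetric_givens_diagonalization[OF Qc sym])
  define V where "V = givens_prod n \<theta>"
  have VV: "V * transpose_mat V = 1\<^sub>m n" and V: "V \<in> carrier_mat n n"
    unfolding V_def givens_prod_rows
    by (rule orthogonal_right orthogonal_carrier, rule orthogonal_givens_rows)+
  have "lam i \<ge> 0" if "i < n" for i
  proof -
    have "lam i = (transpose_mat V * Q * V) $$ (i, i)"
      using that unfolding V_def d by (simp add: mat_diag_def)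
    then show ?thesis
      using psd_mat_diag_nonneg[OF psd_mat_congruence[OF Q, of "transpose_mat V" n] that] V
      by (simp only: transpose_transpose transpose_carrier_mat)
  qed
  moreover have "V * mat_diag n lam * transpose_mat V = (V * transpose_mat V) * Q * (V * transpose_mat V)"
    unfolding d[symmetric] V_def[symmetric] using V Qc
    by (simp add: assoc_mult_mat[of _ n n _ n _ n])
  then have "Q = V * mat_diag n lam * transpose_mat V"
    using VV Qc by simp
  ultimately show ?thesis using that unfolding V_def by blast
qed

lemma det_mat_diag: "det (mat_diag n f) = (\<Prod>i<n. f i :: real)"
proof -
  have "det (mat_diag n f) = prod_list (diag_mat (mat_diag n f))"
    by (rule det_upper_triangular[of _ n]) (auto simp: mat_diag_def)
  also have "\<dots> = (\<Prod>i<n. f i)"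
    by (simp add: prod_list_diag_prod mat_diag_def atLeast0LessThan)
  finally show ?thesis .
qed

text \<open>Orthogonal conjugation reduces the determinant to the product of the
  \<open>1 + lam i\<close>. Both determinants in the rate are of this kind.\<close>

lemma det_one_plus_psd_pos:
  assumes Q: "psd_mat n Q"
  shows "det (1\<^sub>m n + Q) > 0"
proof -
  obtain lam \<theta> where lam: "\<And>i. i < n \<Longrightarrow> lam i \<ge> 0"
    and Qd: "Q = givens_prod n \<theta> * mat_diag n lam * transpose_mat (givens_prod n \<theta>)"
    using psd_givens_decomposition[OF Q] by metis
  define V where "V = givens_prod n \<theta>"
  have VV: "V * transpose_mat V = 1\<^sub>m n" and V: "V \<in> carrier_mat n n"
    unfolding V_def givens_prod_rows
    by (rule orthogonal_right orthogonal_carrier, rule orthogonal_givens_rows)+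
  have "V * (1\<^sub>m n + mat_diag n lam) * transpose_mat V =
      V * 1\<^sub>m n * transpose_mat V + V * mat_diag n lam * transpose_mat V"
    using V mult_add_distrib_mat[OF V one_carrier_mat mat_diag_dim]
      add_mult_distrib_mat[of "V * 1\<^sub>m n" n n "V * mat_diag n lam" "transpose_mat V" n]
    by simp
  then have "1\<^sub>m n + Q = V * (1\<^sub>m n + mat_diag n lam) * transpose_mat V"
    using V VV unfolding Qd V_def[symmetric] by simp
  also have "1\<^sub>m n + mat_diag n lam = mat_diag n (\<lambda>i. 1 + lam i)"
    by (rule eq_matI) (auto simp: mat_diag_def)
  finally have "det (1\<^sub>m n + Q) = det V * det (transpose_mat V) * (\<Prod>i<n. 1 + lam i)"
    using V by (simp add: det_mult[of _ n] det_mat_diag)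
  also have "det V * det (transpose_mat V) = 1"
    using V VV by (simp add: det_mult[of _ n, symmetric])
  finally have "det (1\<^sub>m n + Q) = (\<Prod>i<n. 1 + lam i)"
    by simp
  also have "\<dots> > 0"
    using lam by (intro prod_pos) (auto simp: add_pos_nonneg)
  finally show ?thesis .
qed

text \<open>The form at the sum and difference of two unit vectors bounds twice the entry by two
  diagonal entries, each at most the trace. This makes the feasible set bounded.\<close>

lemma psd_mat_entry_le_trace:
  assumes Q: "psd_mat n Q" and ij: "i < n" "j < n"
  shows "\<bar>Q $$ (i, j)\<bar> \<le> mat_trace Q"
proof -
  have Qc: "Q \<in> carrier_mat n n" and sym: "transpose_mat Q = Q" using Q by (auto simp: psd_mat_def)
  have nonneg: "0 \<le> x \<bullet> (Q *\<^sub>v x)" if "x \<in> carrier_vec n" for x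
    using that Q by (auto simp: psd_mat_def)
  have s: "Q $$ (j, i) = Q $$ (i, j)" using Qc sym ij by (metis carrier_matD index_transpose_mat(1))
  have "2 * \<bar>Q $$ (i, j)\<bar> \<le> Q $$ (i, i) + Q $$ (j, j)"
    using nonneg[of "unit_vec n i + unit_vec n j"] nonneg[of "unit_vec n i - unit_vec n j"] Qc ij s
    by (simp add: mult_add_distrib_mat_vec[OF Qc] mult_minus_distrib_mat_vec[OF Qc]
        add_scalar_prod_distrib[of _ n] scalar_prod_add_distrib[of _ n]
        minus_scalar_prod_distrib[of _ n] scalar_prod_minus_distrib[of _ n] mult_unit_vec_col)
  moreover have "Q $$ (m, m) \<le> mat_trace Q" if "m < n" for m
    unfolding mat_trace_def using that Qc psd_mat_diag_nonneg[OF Q]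
    by (intro member_le_sum[of m "{..<dim_row Q}" "\<lambda>i. Q $$ (i, i)"]) auto
  ultimately show ?thesis using ij by (smt (verit))
qed

section \<open>Continuity of the rate and compactness of the feasible set\<close>

text \<open>By the Leibniz formula the determinant is a polynomial in the entries.\<close>

lemma continuous_on_det:
  fixes M :: "'x::topological_space \<Rightarrow> real mat"
  assumes "\<And>x. x \<in> S \<Longrightarrow> M x \<in> carrier_mat m m"
    and "\<And>i j. i < m \<Longrightarrow> j < m \<Longrightarrow> continuous_on S (\<lambda>x. M x $$ (i, j))"
  shows "continuous_on S (\<lambda>x. det (M x))"
proof -
  have "continuous_on S (\<lambda>x. \<Sum>p | p permutes {0..<m}. signof p * (\<Prod>i = 0..<m. M x $$ (i, p i)))"
    by (intro continuous_intros assms(2)) (use permutes_in_image in fastforce)+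
  then show ?thesis
    by (rule continuous_on_eq) (simp add: det_def'[OF assms(1)])
qed

lemma continuous_on_mat_mult_entry:
  fixes M N :: "'x::topological_space \<Rightarrow> real mat"
  assumes "\<And>x. M x \<in> carrier_mat a b" "\<And>x. N x \<in> carrier_mat b c"
    and "\<And>i j. i < a \<Longrightarrow> j < b \<Longrightarrow> continuous_on S (\<lambda>x. M x $$ (i, j))"
    and "\<And>i j. i < b \<Longrightarrow> j < c \<Longrightarrow> continuous_on S (\<lambda>x. N x $$ (i, j))"
    and ij: "i < a" "j < c"
  shows "continuous_on S (\<lambda>x. (M x * N x) $$ (i, j))"
proof -
  have "(M x * N x) $$ (i, j) = (\<Sum>k<b. M x $$ (i, k) * N x $$ (k, j))" for x
    using ij assms(1)[of x] assms(2)[of x] by (simp add: scalar_prod_def atLeast0LessThan)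
  then show ?thesis
    using assms(3-) by (auto intro!: continuous_intros)
qed

lemma continuous_on_coord: "continuous_on S (\<lambda>f :: 'i \<Rightarrow> real. f p)"
  by (rule continuous_on_subset[OF continuous_on_product_coordinates]) simp

lemma continuous_on_det_one_plus_congruence:
  fixes H :: "real mat"
  assumes H: "H \<in> carrier_mat m n"
  shows "continuous_on S (\<lambda>f. det (1\<^sub>m m + H * mat n n f * transpose_mat H))"
proof (rule continuous_on_det)
  fix i j assume ij: "i < m" "j < m"
  have "continuous_on S (\<lambda>f. (H * mat n n f * transpose_mat H) $$ (i, j))"
    using H ij by (intro continuous_on_mat_mult_entry[of _ m n _ m]
        continuous_on_mat_mult_entry[of _ m n _ n]) (auto intro: continuous_on_coord)
  then show "continuous_on S (\<lambda>f. (1\<^sub>m m + H * mat n n f * transpose_mat H) $$ (i, j))"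
    using H ij by (auto intro!: continuous_intros)
qed (use H in \<open>auto intro!: add_carrier_mat mult_carrier_mat[of _ m n]\<close>)

lemma continuous_on_secrecy_rate:
  assumes H: "H \<in> carrier_mat m n" and G: "G \<in> carrier_mat e n"
    and S: "\<And>f. f \<in> S \<Longrightarrow> psd_mat n (mat n n f)"
  shows "continuous_on S (\<lambda>f. secrecy_rate H G (mat n n f))"
proof -
  \<comment> \<open>Stated for any channel matrix, so that it covers numerator and denominator: the
    quotient is defined and the logarithm has a positive argument.\<close>
  have pos: "det (1\<^sub>m m + H * mat n n f * transpose_mat H) > 0"
    if "f \<in> S" "H \<in> carrier_mat m n" for f m H
    by (rule det_one_plus_psd_pos[OF psd_mat_congruence[OF S[OF that(1)] that(2)]])
  have dims: "dim_row H = m" "dim_row G = e" using H G by auto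
  show ?thesis
    unfolding secrecy_rate_def log_def dims
    by (intro continuous_intros continuous_on_det_one_plus_congruence[OF H]
         continuous_on_det_one_plus_congruence[OF G])
      (auto dest: pos[OF _ H] pos[OF _ G])
qed

text \<open>Matrices of type \<open>real mat\<close> carry no topology, so compactness and continuity are expressed for
  entry functions, which vanish outside the index range.\<close>

definition feasible :: "nat \<Rightarrow> real \<Rightarrow> (nat \<times> nat \<Rightarrow> real) set" where
  "feasible n P = {f. psd_mat n (mat n n f) \<and> mat_trace (mat n n f) \<le> P \<and>
     (\<forall>p. p \<notin> {..<n} \<times> {..<n} \<longrightarrow> f p = 0)}"

text \<open>Symmetry, the form inequality for each single \<open>x\<close> and the trace bound are
  closed conditions on finitely many entries, and the trace bounds every entry.\<close>

lemma compact_feasible: "compact (feasible n P)"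
proof -
  let ?B = "{f :: nat \<times> nat \<Rightarrow> real. \<forall>p. if p \<in> {..<n} \<times> {..<n} then \<bar>f p\<bar> \<le> P else f p = 0}"
  define C where "C = {f :: nat \<times> nat \<Rightarrow> real. (\<forall>i j. i < n \<and> j < n \<longrightarrow> f (i, j) = f (j, i)) \<and>
      (\<forall>x. x \<in> carrier_vec n \<longrightarrow> 0 \<le> (\<Sum>i<n. x $ i * (\<Sum>j<n. f (i, j) * x $ j))) \<and>
      (\<Sum>i<n. f (i, i)) \<le> P}"
  have "closed C"
    unfolding C_def by (intro closed_Collect_conj closed_Collect_all closed_Collect_imp closed_Collect_eq
        closed_Collect_le continuous_intros continuous_on_coord) auto
  then have "compact (?B \<inter> C)"
    by (intro compact_Int_closed compact_box)
  moreover have "feasible n P = ?B \<inter> C"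
  proof -
    have sym: "transpose_mat (mat n n f) = mat n n f \<longleftrightarrow>
        (\<forall>i j. i < n \<and> j < n \<longrightarrow> f (i, j) = f (j, i))" for f :: "nat \<times> nat \<Rightarrow> real"
      by (auto simp: mat_eq_iff)
    have quad: "x \<bullet> (mat n n f *\<^sub>v x) = (\<Sum>i<n. x $ i * (\<Sum>j<n. f (i, j) * x $ j))"
      if "x \<in> carrier_vec n" for f and x :: "real vec"
      using that by (simp add: scalar_prod_def atLeast0LessThan)
    have psd: "psd_mat n (mat n n f) \<and> mat_trace (mat n n f) \<le> P \<longleftrightarrow> f \<in> C" for f
      by (auto simp: C_def psd_mat_def mat_trace_def sym quad)
    have "\<bar>f (i, j)\<bar> \<le> P" if "psd_mat n (mat n n f) \<and> mat_trace (mat n n f) \<le> P" "i < n" "j < n" for f i j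
      using psd_mat_entry_le_trace[of n "mat n n f" i j] that by simp
    then show ?thesis
      unfolding feasible_def conj_assoc[symmetric] psd[symmetric]
      by (auto simp: psd[symmetric])
  qed
  ultimately show ?thesis by simp
qed

section \<open>Attainment of the capacity in Givens form\<close>

lemma secrecy_capacity_attained:
  assumes H: "H \<in> carrier_mat m n" and G: "G \<in> carrier_mat e n" and P: "P \<ge> 0"
  obtains Q where "psd_mat n Q" "mat_trace Q \<le> P" "secrecy_rate H G Q = secrecy_capacity n H G P"
    "\<And>Q'. psd_mat n Q' \<Longrightarrow> mat_trace Q' \<le> P \<Longrightarrow> secrecy_rate H G Q' \<le> secrecy_rate H G Q"
proof -
  \<comment> \<open>The zero matrix is feasible, so the set over which the rate is maximized is
    nonempty.\<close>
  have "x \<bullet> (mat n n (\<lambda>_. 0) *\<^sub>v x) = 0" if "x \<in> carrier_vec n" for x :: "real vec"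
    using that by (simp add: scalar_prod_def)
  then have "(\<lambda>_. 0) \<in> feasible n P"
    using P by (auto simp: feasible_def psd_mat_def mat_trace_def)
  then have ne: "feasible n P \<noteq> {}" by auto
  have "continuous_on (feasible n P) (\<lambda>f. secrecy_rate H G (mat n n f))"
    by (rule continuous_on_secrecy_rate[OF H G]) (simp add: feasible_def)
  then obtain f where f: "f \<in> feasible n P"
    and max: "\<And>g. g \<in> feasible n P \<Longrightarrow> secrecy_rate H G (mat n n g) \<le> secrecy_rate H G (mat n n f)"
    using continuous_attains_sup[OF compact_feasible ne] by blast
  define Q where "Q = mat n n f"
  have Q: "psd_mat n Q" "mat_trace Q \<le> P" using f by (auto simp: feasible_def Q_def)
  have le: "secrecy_rate H G Q' \<le> secrecy_rate H G Q" if "psd_mat n Q'" "mat_trace Q' \<le> P" for Q'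
  proof -
    \<comment> \<open>The entries of \<open>Q'\<close> are cut off outside the index range, as
      \<open>feasible\<close> demands.\<close>
    define g where "g = (\<lambda>p. if p \<in> {..<n} \<times> {..<n} then Q' $$ p else 0)"
    have "mat n n g = Q'" using that by (intro eq_matI) (auto simp: g_def psd_mat_def)
    moreover from this have "g \<in> feasible n P" using that by (auto simp: feasible_def g_def)
    ultimately show ?thesis using max[of g] by (simp add: Q_def)
  qed
  moreover have "secrecy_capacity n H G P = secrecy_rate H G Q"
    unfolding secrecy_capacity_def by (rule Greatest_equality) (use Q le in auto)
  ultimately show ?thesis using that Q by auto
qed

text \<open>The upper bound in the first conjunct, together with attainment in the second, shows
  that the \<open>GREATEST\<close> in \<open>secrecy_capacity\<close> is a genuine maximum. The
  proof decomposes an arbitrary maximizer.\<close>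

theorem lemma1:
  fixes n_t n_r n_e :: nat and H G :: "real mat" and P_t :: real
  assumes "n_t \<ge> 2" and "n_r \<ge> 1" and "n_e \<ge> 1"
    and "H \<in> carrier_mat n_r n_t" and "G \<in> carrier_mat n_e n_t"
    and "P_t > 0"
  shows "(\<forall>Q. psd_mat n_t Q \<and> mat_trace Q \<le> P_t \<longrightarrow>
            secrecy_rate H G Q \<le> secrecy_capacity n_t H G P_t) \<and>
         (\<exists>(lam :: nat \<Rightarrow> real) (\<theta> :: nat \<Rightarrow> nat \<Rightarrow> real).
            (\<forall>i<n_t. lam i \<ge> 0) \<and>
            (let V = givens_prod n_t \<theta>;
                 Q = V * mat_diag n_t lam * transpose_mat V
             in psd_mat n_t Q \<and> mat_trace Q \<le> P_t \<and>
                secrecy_rate H G Q = secrecy_capacity n_t H G P_t))"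
proof -
  obtain Q where Q: "psd_mat n_t Q" "mat_trace Q \<le> P_t"
      "secrecy_rate H G Q = secrecy_capacity n_t H G P_t"
    and max: "\<And>Q'. psd_mat n_t Q' \<Longrightarrow> mat_trace Q' \<le> P_t \<Longrightarrow>
      secrecy_rate H G Q' \<le> secrecy_rate H G Q"
    using secrecy_capacity_attained[OF assms(4,5), of P_t] assms(6) by auto
  obtain lam \<theta> where lam: "\<And>i. i < n_t \<Longrightarrow> lam i \<ge> 0"
    and Qd: "Q = givens_prod n_t \<theta> * mat_diag n_t lam * transpose_mat (givens_prod n_t \<theta>)"
    using psd_givens_decomposition[OF Q(1)] by metis
  show ?thesis
  proof (intro conjI exI[of _ lam] exI[of _ \<theta>])
    show "\<forall>Q. psd_mat n_t Q \<and> mat_trace Q \<le> P_t \<longrightarrow>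
        secrecy_rate H G Q \<le> secrecy_capacity n_t H G P_t"
      using max Q(3) by simp
    show "\<forall>i<n_t. lam i \<ge> 0" using lam by simp
    show "let V = givens_prod n_t \<theta>; Q = V * mat_diag n_t lam * transpose_mat V
        in psd_mat n_t Q \<and> mat_trace Q \<le> P_t \<and> secrecy_rate H G Q = secrecy_capacity n_t H G P_t"
      using Q unfolding Let_def Qd[symmetric] by simp
  qed
qed

end
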